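(* Let $T\in\mathbb N$, $\Delta\in\mathbb R^n$, and let $\mathscr R_{T,\Delta}$ be the full residual map on trajectories $z=(z_0,\dots,z_T)\in X_T=(\mathbb R^n)^{T+1}$, $$\mathscr R_{T,\Delta}(z)=\bigl(\mathcal F(z_0,z_1),\dots,\mathcal F(z_{T-1},z_T),\ \mathcal B(z_0,z_T)-\Delta\bigr)\in\mathbb R^{n(T+1)} .$$ Equip $X_T$ with a chosen norm $\|\cdot\|_X$. Let $\bar z\in X_T$ be an approximate solution, put $J=D\mathscr R_{T,\Delta}(\bar z)$, suppose $J$ is invertible, and define $$\beta=\|J^{-1}\mathscr R_{T,\Delta}(\bar z)\|_X .$$ Let $\omega\ge0$ and $R_{\rm tube}\in(0,\infty]$ be such that, whenever $z$ and $\tilde z$ lie in $\|\cdot-\bar z\|_X\le R_{\rm tube}$, $$\|J^{-1}(D\mathscr R_{T,\Delta}(z)-D\mathscr R_{T,\Delta}(\tilde z))\|_{\mathcal L(X_T)}\le\omega\|z-\tilde z\|_X .$$ If $2\omega\beta<1$ and $$r_-:=\frac{1-\sqrt{1-2\omega\beta}}{\omega}<R_{\rm tube},$$ then an exact solution of $\mathscr R_{T,\Delta}(z)=0$ exists in $\|z-\bar z\|_X\le r_-$. For every $R$ with $$r_-<R<\min\{R_{\rm tube},1/\omega\},$$ it is the unique zero of $\mathscr R_{T,\Delta}$ in $\|z-\bar z\|_X<R$. For $\omega=0$, the conventions are $r_-=\beta$ and $1/\omega=+\infty$.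
   Context: $\mathcal F:\mathbb R^n\times\mathbb R^n\to\mathbb R^n$ (interior equation) and $\mathcal B:\mathbb R^n\times\mathbb R^n\to\mathbb R^n$ (boundary map) are $C^2$ near the origin, and the nonlinear boundary-value problem is $\mathcal F(z_t,z_{t+1})=0$ for $0\le t<T$, $\mathcal B(z_0,z_T)=\Delta$. The ball $\|z-\bar z\|_X\le R_{\rm tube}$ is contained in the region of trajectories where $\mathcal F$ and $\mathcal B$ are defined and $C^2$. $\|\cdot\|_{\mathcal L(X_T)}$ is the operator norm induced by $\|\cdot\|_X$. *)

theory Defs
  imports "HOL-Analysis.Analysis"
begin

definition C2_on :: "('a::real_normed_vector) set \<Rightarrow> ('a \<Rightarrow> 'b::real_normed_vector) \<Rightarrow> bool" where
  "C2_on U f \<longleftrightarrow> open U \<and>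
     (\<exists>(f' :: 'a \<Rightarrow> 'a \<Rightarrow>\<^sub>L 'b) (f'' :: 'a \<Rightarrow> 'a \<Rightarrow>\<^sub>L ('a \<Rightarrow>\<^sub>L 'b)).
        (\<forall>x\<in>U. (f has_derivative blinfun_apply (f' x)) (at x)) \<and>
        (\<forall>x\<in>U. (f' has_derivative blinfun_apply (f'' x)) (at x)) \<and>
        continuous_on U f'')"

(* An arbitrary norm, not necessarily the one of the type class. *)
definition is_norm :: "('a::real_vector \<Rightarrow> real) \<Rightarrow> bool" where
  "is_norm N \<longleftrightarrow>
     (\<forall>x. 0 \<le> N x) \<and> (\<forall>x. N x = 0 \<longleftrightarrow> x = 0) \<and>
     (\<forall>x y. N (x + y) \<le> N x + N y) \<and> (\<forall>c x. N (c *\<^sub>R x) = \<bar>c\<bar> * N x)"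

(* As for onorm, the quotient at x = 0 is 0 / 0 = 0. The supremum is a genuine one for
   linear A on a finite-dimensional space, where the set of quotients is bounded. *)
definition op_norm :: "('a::real_vector \<Rightarrow> real) \<Rightarrow> ('a \<Rightarrow> 'a) \<Rightarrow> real" where
  "op_norm N A = (SUP x. N (A x) / N x)"

(* X_T = (R^n)^(T+1) is the type real^'n^'t, where e :: nat => 't enumerates the T + 1 elements
   of the index type 't as e 0, ..., e T (bij_betw e {0..T} UNIV); z_t is z $ e t.
   The block at e t is F(z_t, z_(t+1)) for t < T, and the block at e T is B(z_0, z_T) - Delta. *)
definition residual ::
  "nat \<Rightarrow> (nat \<Rightarrow> 't::finite) \<Rightarrow> ((real^'n) \<times> (real^'n) \<Rightarrow> real^'n) \<Rightarrow> ((real^'n) \<times> (real^'n) \<Rightarrow> real^'n)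
    \<Rightarrow> real^'n \<Rightarrow> real^'n^'t \<Rightarrow> real^'n^'t" where
  "residual T e F B \<Delta> z =
     (\<chi> i. let t = inv_into {0..T} e i in
        if t < T then F (z $ e t, z $ e (Suc t)) else B (z $ e 0, z $ e T) - \<Delta>)"

end

theory Submission
  imports Defs
begin

text \<open>A zero of the residual map \<open>f\<close> is a fixed point of the simplified Newton map
  \<open>g z = z - J\<inverse> f z\<close>. Its derivative is \<open>J\<inverse> (J - Df z)\<close>, of norm at most \<open>\<omega> N (z - zbar)\<close>.
  So \<open>g\<close> contracts every ball of radius \<open>s < 1 / \<omega>\<close> in the tube, which gives uniqueness,
  while \<open>N (g z - zbar) \<le> \<beta> + \<omega> N (z - zbar)\<^sup>2 / 2\<close>, and \<open>r\<close> is the smaller root of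
  \<open>\<beta> + \<omega> s\<^sup>2 / 2 = s\<close>, so that \<open>g\<close> maps the closed ball of radius \<open>r\<close> into itself.\<close>

section \<open>Arbitrary norms in finite dimension\<close>

lemma is_normD:
  assumes "is_norm N"
  shows "0 \<le> N x" "N x = 0 \<longleftrightarrow> x = 0" "N (x + y) \<le> N x + N y" "N (c *\<^sub>R x) = \<bar>c\<bar> * N x"
  using assms unfolding is_norm_def by auto

lemma is_norm_minus:
  assumes "is_norm N"
  shows "N (- x) = N x"
  using is_normD(4)[OF assms, of "-1" x] by simp

lemma is_norm_minus_commute:
  assumes "is_norm N"
  shows "N (x - y) = N (y - x)"
  using is_norm_minus[OF assms, of "x - y"] by simp

text \<open>Expand \<open>x\<close> in \<open>Basis\<close>: each coordinate is at most
  \<open>norm x\<close>, so the triangle inequality gives the sum of the \<open>N b\<close> as a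
  constant. The extra 1 makes it visibly positive.\<close>

lemma is_norm_upper_bound:
  fixes N :: "'a::euclidean_space \<Rightarrow> real"
  assumes N: "is_norm N"
  obtains C where "0 < C" "\<And>x. N x \<le> C * norm x"
proof -
  have sum_le: "N (\<Sum>b\<in>A. h b) \<le> (\<Sum>b\<in>A. N (h b))" if "finite A" for A and h :: "'a \<Rightarrow> 'a"
    using that
  proof (induction A rule: finite_induct)
    case empty
    then show ?case using is_normD(2)[OF N, of 0] by simp
  next
    case (insert b A)
    then show ?case using is_normD(3)[OF N, of "h b" "\<Sum>b\<in>A. h b"] by simp
  qed
  have "N x \<le> (1 + (\<Sum>b\<in>Basis. N b)) * norm x" for x
  proof -
    have "N x = N (\<Sum>b\<in>Basis. (x \<bullet> b) *\<^sub>R b)" by (simp add: euclidean_representation)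
    also have "\<dots> \<le> (\<Sum>b\<in>Basis. N ((x \<bullet> b) *\<^sub>R b))" by (rule sum_le) simp
    also have "\<dots> \<le> (\<Sum>b\<in>Basis. norm x * N b)"
      by (intro sum_mono) (auto simp: is_normD[OF N] intro!: mult_right_mono Basis_le_norm)
    also have "\<dots> = (\<Sum>b\<in>Basis. N b) * norm x" by (simp add: sum_distrib_left mult.commute)
    also have "\<dots> \<le> (1 + (\<Sum>b\<in>Basis. N b)) * norm x" by (simp add: algebra_simps)
    finally show ?thesis .
  qed
  moreover have "0 < 1 + (\<Sum>b\<in>Basis. N b)"
    using sum_nonneg[of Basis N] is_normD(1)[OF N] by (simp add: add_pos_nonneg)
  ultimately show ?thesis using that by blast
qed

text \<open>By the reverse triangle inequality \<open>N\<close> is Lipschitz with the constant of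
  the upper bound.\<close>

lemma continuous_on_is_norm:
  fixes N :: "'a::euclidean_space \<Rightarrow> real"
  assumes N: "is_norm N"
  shows "continuous_on A N"
proof -
  obtain C where C: "0 < C" "\<And>x. N x \<le> C * norm x" using is_norm_upper_bound[OF N] by blast
  have lip: "dist (N x) (N y) \<le> C * dist x y" for x y
  proof -
    have "N x \<le> N (x - y) + N y" "N y \<le> N (x - y) + N x"
      using is_normD(3)[OF N, of "x - y" y] is_normD(3)[OF N, of "y - x" x]
        is_norm_minus_commute[OF N, of x y] by auto
    then show ?thesis using C(2)[of "x - y"] by (simp add: dist_norm)
  qed
  have "C-lipschitz_on A N"
    by (rule lipschitz_onI) (use lip C in auto)
  then show ?thesis by (rule lipschitz_on_continuous_on)
qed

text \<open>The constant is the minimum of \<open>N\<close> on the Euclidean unit sphere, attained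
  by compactness and positive by definiteness; homogeneity extends the bound to all vectors.\<close>

lemma is_norm_lower_bound:
  fixes N :: "'a::euclidean_space \<Rightarrow> real"
  assumes N: "is_norm N"
  obtains c where "0 < c" "\<And>x. c * norm x \<le> N x"
proof -
  have "compact (sphere (0::'a) 1)" "sphere (0::'a) 1 \<noteq> {}" by auto
  then obtain u where u: "u \<in> sphere 0 1" "\<And>y. y \<in> sphere 0 1 \<Longrightarrow> N u \<le> N y"
    using continuous_attains_inf[OF _ _ continuous_on_is_norm[OF N]] by metis
  have "0 < N u" using u(1) is_normD(1,2)[OF N, of u] by force
  moreover have "N u * norm x \<le> N x" for x
  proof (cases "x = 0")
    case False
    then have "N u \<le> N ((1 / norm x) *\<^sub>R x)" by (intro u(2)) simp
    then show ?thesis using False by (simp add: is_normD[OF N] field_simps)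
  qed (use is_normD(1)[OF N] in simp)
  ultimately show ?thesis using that by blast
qed

lemma compact_is_norm_ball:
  fixes N :: "'a::euclidean_space \<Rightarrow> real"
  assumes N: "is_norm N"
  shows "compact {z. N (z - a) \<le> r}"
proof -
  obtain c where c: "0 < c" "\<And>x. c * norm x \<le> N x" using is_norm_lower_bound[OF N] by blast
  have "bounded {z. N (z - a) \<le> r}"
  proof (rule bounded_subset[of "cball a (r / c)"])
    show "{z. N (z - a) \<le> r} \<subseteq> cball a (r / c)"
    proof
      fix z assume "z \<in> {z. N (z - a) \<le> r}"
      then have "c * norm (z - a) \<le> r" using c(2)[of "z - a"] by simp
      then show "z \<in> cball a (r / c)"
        using c(1) by (simp add: dist_norm norm_minus_commute field_simps)
    qed
  qed simp
  moreover have "closed {z. N (z - a) \<le> r}"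
    by (intro closed_Collect_le continuous_on_compose2[OF continuous_on_is_norm[OF N, of UNIV]]
        continuous_intros subset_UNIV)
  ultimately show ?thesis by (simp add: compact_eq_bounded_closed)
qed

text \<open>The real-valued \<open>SUP\<close> bounds its quotients only if they are bounded above.
  Comparing \<open>N\<close> with the Euclidean norm on both sides bounds them by
  \<open>C * K / c\<close>.\<close>

lemma le_op_norm:
  fixes N :: "'a::euclidean_space \<Rightarrow> real"
  assumes N: "is_norm N" and A: "linear A"
  shows "N (A h) \<le> op_norm N A * N h"
proof -
  obtain C where C: "0 < C" "\<And>x. N x \<le> C * norm x" using is_norm_upper_bound[OF N] by blast
  obtain c where c: "0 < c" "\<And>x. c * norm x \<le> N x" using is_norm_lower_bound[OF N] by blast
  obtain K where K: "0 < K" "\<And>x. norm (A x) \<le> K * norm x"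
    using linear_bounded_pos[OF A] by blast
  have "N (A x) / N x \<le> C * K / c" for x
  proof (cases "x = 0")
    case True
    then show ?thesis using C(1) K(1) c(1) is_normD(2)[OF N, of 0] by simp
  next
    case False
    then have pos: "0 < N x" using is_normD(1,2)[OF N, of x] by force
    have "N (A x) \<le> C * norm (A x)" by (rule C)
    also have "\<dots> \<le> C * (K * norm x)" using K(2) C(1) by simp
    also have "\<dots> = C * K / c * (c * norm x)" using c(1) by simp
    also have "\<dots> \<le> C * K / c * N x"
      by (rule mult_left_mono[OF c(2)]) (use C(1) K(1) c(1) in simp)
    finally show ?thesis using pos by (simp add: pos_divide_le_eq)
  qed
  then have "bdd_above (range (\<lambda>x. N (A x) / N x))" by (intro bdd_aboveI) auto
  then have le: "N (A h) / N h \<le> op_norm N A"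
    unfolding op_norm_def by (intro cSUP_upper) auto
  show ?thesis
  proof (cases "h = 0")
    case True
    then show ?thesis using is_normD(2)[OF N, of 0] linear_0[OF A] by simp
  next
    case False
    then have "0 < N h" using is_normD(1,2)[OF N, of h] by force
    then show ?thesis using le by (simp add: pos_divide_le_eq)
  qed
qed

section \<open>Mean value inequality for an arbitrary norm\<close>

text \<open>The library's mean value inequalities concern the norm of the type class.\<close>
lemma is_norm_mean_value:
  fixes N :: "'a::euclidean_space \<Rightarrow> real" and f :: "real \<Rightarrow> 'a"
  assumes N: "is_norm N" and "a \<le> b"
    and f: "\<And>x. x \<in> {a..b} \<Longrightarrow> (f has_vector_derivative f' x) (at x within {a..b})"
    and \<phi>: "\<And>x. x \<in> {a..b} \<Longrightarrow> (\<phi> has_vector_derivative \<phi>' x) (at x within {a..b})"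
    and le: "\<And>x. x \<in> {a..b} \<Longrightarrow> N (f' x) \<le> \<phi>' x"
  shows "N (f b - f a) \<le> \<phi> b - \<phi> a"
proof (rule field_le_epsilon)
  fix \<epsilon> :: real assume "0 < \<epsilon>"
  \<comment> \<open>The slack is spread over the interval at rate \<open>\<eta>\<close> per unit
    length; the 1 in the denominator covers \<open>a = b\<close>.\<close>
  define \<eta> where "\<eta> = \<epsilon> / (b - a + 1)"
  have \<eta>: "0 < \<eta>" using \<open>0 < \<epsilon>\<close> \<open>a \<le> b\<close> unfolding \<eta>_def by simp
  obtain C where C: "0 < C" "\<And>x. N x \<le> C * norm x" using is_norm_upper_bound[OF N] by blast
  \<comment> \<open>Bisection: the estimate with slack passes from two adjacent intervals to their
    union, so it need only hold on short intervals around each point. The guards are there because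
    such intervals may stick out of \<open>{a..b}\<close>.\<close>
  have "a \<le> a \<longrightarrow> b \<le> b \<longrightarrow> N (f b - f a) \<le> \<phi> b - \<phi> a + \<eta> * (b - a)"
  proof (rule Bolzano[OF \<open>a \<le> b\<close>, where P = "\<lambda>u v. a \<le> u \<longrightarrow> v \<le> b \<longrightarrow> N (f v - f u) \<le> \<phi> v - \<phi> u + \<eta> * (v - u)"])
    fix u v w
    assume uv: "a \<le> u \<longrightarrow> v \<le> b \<longrightarrow> N (f v - f u) \<le> \<phi> v - \<phi> u + \<eta> * (v - u)"
      and vw: "a \<le> v \<longrightarrow> w \<le> b \<longrightarrow> N (f w - f v) \<le> \<phi> w - \<phi> v + \<eta> * (w - v)"
      and "u \<le> v" "v \<le> w"
    show "a \<le> u \<longrightarrow> w \<le> b \<longrightarrow> N (f w - f u) \<le> \<phi> w - \<phi> u + \<eta> * (w - u)"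
      using uv vw \<open>u \<le> v\<close> \<open>v \<le> w\<close> is_normD(3)[OF N, of "f w - f v" "f v - f u"]
      by (auto simp: algebra_simps)
  next
    fix x assume x: "a \<le> x" "x \<le> b"
    \<comment> \<open>The part \<open>C * \<delta>\<close> of \<open>\<eta>\<close> pays for the
      error of \<open>f\<close> measured in \<open>N\<close>, the remaining \<open>\<delta>\<close>
      for that of \<open>\<phi>\<close>.\<close>
    define \<delta> where "\<delta> = \<eta> / (C + 1)"
    have "0 < \<delta>" "(C + 1) * \<delta> = \<eta>" using \<eta> C(1) by (auto simp: \<delta>_def)
    then have \<delta>: "0 < \<delta>" "C * \<delta> + \<delta> = \<eta>" by (auto simp: distrib_right)
    obtain d1 where d1: "0 < d1" "\<And>y. y \<in> {a..b} \<Longrightarrow> norm (y - x) < d1 \<Longrightarrow>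
        norm (f y - f x - (y - x) *\<^sub>R f' x) \<le> \<delta> * norm (y - x)"
      using f[of x] x \<delta>(1) unfolding has_vector_derivative_def has_derivative_within_alt by fastforce
    obtain d2 where d2: "0 < d2" "\<And>y. y \<in> {a..b} \<Longrightarrow> norm (y - x) < d2 \<Longrightarrow>
        norm (\<phi> y - \<phi> x - (y - x) *\<^sub>R \<phi>' x) \<le> \<delta> * norm (y - x)"
      using \<phi>[of x] x \<delta>(1) unfolding has_vector_derivative_def has_derivative_within_alt by fastforce
    have "N (f v - f u) \<le> \<phi> v - \<phi> u + \<eta> * (v - u)"
      if uv: "u \<le> x" "x \<le> v" "v - u < min d1 d2" "a \<le> u" "v \<le> b" for u v
    proof -
      \<comment> \<open>Both endpoints are linearised at the intermediate point \<open>x\<close>. As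
        \<open>u \<le> x \<le> v\<close>, the errors, proportional to \<open>v - x\<close> and
        \<open>x - u\<close>, add up to a multiple of \<open>v - u\<close>.\<close>
      define p where "p = f v - f x - (v - x) *\<^sub>R f' x"
      define q where "q = f u - f x - (u - x) *\<^sub>R f' x"
      have p: "N p \<le> C * (\<delta> * (v - x))" and q: "N q \<le> C * (\<delta> * (x - u))"
        using C(2)[of p] C(2)[of q] C(1) d1(2)[of v] d1(2)[of u] uv
        by (force simp: p_def q_def intro: order_trans mult_left_mono)+
      have "\<bar>\<phi> v - \<phi> x - (v - x) * \<phi>' x\<bar> \<le> \<delta> * (v - x)"
        "\<bar>\<phi> u - \<phi> x - (u - x) * \<phi>' x\<bar> \<le> \<delta> * (x - u)"
        using d2(2)[of v] d2(2)[of u] uv by auto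
      then have phi: "(v - u) * \<phi>' x \<le> \<phi> v - \<phi> u + \<delta> * (v - u)"
        by (simp add: algebra_simps abs_le_iff)
      have "f v - f u = (p + - q) + (v - u) *\<^sub>R f' x" by (simp add: p_def q_def algebra_simps)
      then have "N (f v - f u) \<le> N p + N q + (v - u) * N (f' x)"
        using is_normD(3)[OF N, of "p + - q" "(v - u) *\<^sub>R f' x"] is_normD(3)[OF N, of p "- q"] uv
        by (simp add: is_normD(4)[OF N] is_norm_minus[OF N])
      also have "\<dots> \<le> C * (\<delta> * (v - x)) + C * (\<delta> * (x - u)) + (v - u) * \<phi>' x"
        using p q le[of x] x uv by (intro add_mono mult_left_mono) auto
      also have "\<dots> \<le> C * (\<delta> * (v - x)) + C * (\<delta> * (x - u)) + (\<phi> v - \<phi> u + \<delta> * (v - u))"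
        using phi by simp
      also have "\<dots> = \<phi> v - \<phi> u + (C * \<delta> + \<delta>) * (v - u)" by (simp add: algebra_simps)
      finally show ?thesis using \<delta>(2) by simp
    qed
    then show "\<exists>d>0. \<forall>u v. u \<le> x \<and> x \<le> v \<and> v - u < d \<longrightarrow>
        (a \<le> u \<longrightarrow> v \<le> b \<longrightarrow> N (f v - f u) \<le> \<phi> v - \<phi> u + \<eta> * (v - u))"
      using d1(1) d2(1) by (intro exI[of _ "min d1 d2"]) auto
  qed
  moreover have "\<eta> * (b - a) \<le> \<epsilon>"
    using \<open>0 < \<epsilon>\<close> \<open>a \<le> b\<close> unfolding \<eta>_def by (simp add: field_simps)
  ultimately show "N (f b - f a) \<le> \<phi> b - \<phi> a + \<epsilon>" by simp
qed

section \<open>Estimates along segments in a ball\<close>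

lemma convex_is_norm_ball:
  assumes N: "is_norm N"
  shows "convex {z. N (z - a) \<le> s}"
proof (rule convexI)
  fix x y and u v :: real
  assume x: "x \<in> {z. N (z - a) \<le> s}" and y: "y \<in> {z. N (z - a) \<le> s}"
    and uv: "0 \<le> u" "0 \<le> v" "u + v = 1"
  have "u *\<^sub>R x + v *\<^sub>R y - a = u *\<^sub>R x + v *\<^sub>R y - (u + v) *\<^sub>R a" using uv by simp
  also have "\<dots> = u *\<^sub>R (x - a) + v *\<^sub>R (y - a)" by (simp add: algebra_simps)
  finally have "N (u *\<^sub>R x + v *\<^sub>R y - a) \<le> u * N (x - a) + v * N (y - a)"
    using is_normD(3)[OF N, of "u *\<^sub>R (x - a)" "v *\<^sub>R (y - a)"] uv by (simp add: is_normD(4)[OF N])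
  also have "\<dots> \<le> u * s + v * s" using x y uv by (intro add_mono mult_left_mono) auto
  also have "\<dots> = s" using uv by (metis distrib_right mult_1)
  finally show "u *\<^sub>R x + v *\<^sub>R y \<in> {z. N (z - a) \<le> s}" by simp
qed

lemma has_vector_derivative_along_line:
  assumes "(g has_derivative g') (at (x + t *\<^sub>R h))"
  shows "((\<lambda>t. g (x + t *\<^sub>R h)) has_vector_derivative g' h) (at t within S)"
proof -
  have "((\<lambda>t. x + t *\<^sub>R h) has_derivative (\<lambda>t. t *\<^sub>R h)) (at t within S)"
    by (auto intro!: derivative_eq_intros)
  from has_derivative_compose[OF this assms]
  have "((\<lambda>t. g (x + t *\<^sub>R h)) has_derivative (\<lambda>t. g' (t *\<^sub>R h))) (at t within S)" .
  then show ?thesis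
    using linear_scale[OF has_derivative_linear[OF assms]]
    unfolding has_vector_derivative_def by simp
qed

text \<open>The segment from \<open>x\<close> to \<open>y\<close> stays in the convex ball, where
  the derivative has norm at most \<open>\<omega> * s\<close>; compare with a linear
  \<open>\<phi>\<close>.\<close>

lemma is_norm_contraction_on_ball:
  fixes N :: "'a::euclidean_space \<Rightarrow> real" and g :: "'a \<Rightarrow> 'a"
  assumes N: "is_norm N" and "0 \<le> \<omega>"
    and g: "\<And>z. N (z - a) \<le> s \<Longrightarrow> (g has_derivative g' z) (at z)"
    and g': "\<And>z h. N (z - a) \<le> s \<Longrightarrow> N (g' z h) \<le> \<omega> * N (z - a) * N h"
    and x: "N (x - a) \<le> s" and y: "N (y - a) \<le> s"
  shows "N (g y - g x) \<le> \<omega> * s * N (y - x)"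
proof -
  define l where "l t = x + t *\<^sub>R (y - x)" for t
  have l: "N (l t - a) \<le> s" if "t \<in> {0..1}" for t
  proof -
    have "l t = (1 - t) *\<^sub>R x + t *\<^sub>R y" by (simp add: l_def algebra_simps)
    then show ?thesis
      using convexD[OF convex_is_norm_ball[OF N], of x a s y "1 - t" t] x y that by simp
  qed
  have "N (g (l 1) - g (l 0)) \<le> (\<omega> * s * N (y - x)) * 1 - (\<omega> * s * N (y - x)) * 0"
  proof (rule is_norm_mean_value[OF N, where f' = "\<lambda>t. g' (l t) (y - x)"
        and \<phi>' = "\<lambda>t. \<omega> * s * N (y - x)" and f = "\<lambda>t. g (l t)" and \<phi> = "\<lambda>t. (\<omega> * s * N (y - x)) * t"])
    fix t :: real assume t: "t \<in> {0..1}"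
    show "((\<lambda>t. g (l t)) has_vector_derivative g' (l t) (y - x)) (at t within {0..1})"
      using g[OF l[OF t]] unfolding l_def by (rule has_vector_derivative_along_line)
    show "((\<lambda>t. (\<omega> * s * N (y - x)) * t) has_vector_derivative \<omega> * s * N (y - x)) (at t within {0..1})"
      by (auto intro!: derivative_eq_intros simp: has_real_derivative_iff_has_vector_derivative[symmetric])
    show "N (g' (l t) (y - x)) \<le> \<omega> * s * N (y - x)"
      using g'[OF l[OF t], of "y - x"] l[OF t] \<open>0 \<le> \<omega>\<close> is_normD(1)[OF N]
      by (meson mult_left_mono mult_right_mono order_trans)
  qed simp
  then show ?thesis by (simp add: l_def)
qed

text \<open>On the ray from the centre the derivative bound grows linearly in \<open>t\<close>;
  integrating it yields the factor 1/2, on which the value of the radius \<open>r\<close>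
  rests.\<close>

lemma is_norm_quadratic_bound:
  fixes N :: "'a::euclidean_space \<Rightarrow> real" and g :: "'a \<Rightarrow> 'a"
  assumes N: "is_norm N"
    and g: "\<And>z. N (z - a) \<le> s \<Longrightarrow> (g has_derivative g' z) (at z)"
    and g': "\<And>z h. N (z - a) \<le> s \<Longrightarrow> N (g' z h) \<le> \<omega> * N (z - a) * N h"
    and x: "N (x - a) \<le> s"
  shows "N (g x - g a) \<le> \<omega> * (N (x - a))\<^sup>2 / 2"
proof -
  define l where "l t = a + t *\<^sub>R (x - a)" for t
  have l_norm: "N (l t - a) = t * N (x - a)" if "t \<in> {0..1}" for t
    using that by (simp add: l_def is_normD(4)[OF N])
  have l: "N (l t - a) \<le> s" if "t \<in> {0..1}" for t
    using l_norm[OF that] that x mult_left_le_one_le[of "N (x - a)" t] is_normD(1)[OF N] by simp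
  define c where "c = \<omega> * (N (x - a))\<^sup>2"
  have "N (g (l 1) - g (l 0)) \<le> c * 1\<^sup>2 / 2 - c * 0\<^sup>2 / 2"
  proof (rule is_norm_mean_value[OF N, where f' = "\<lambda>t. g' (l t) (x - a)"
        and \<phi>' = "\<lambda>t. c * t" and f = "\<lambda>t. g (l t)" and \<phi> = "\<lambda>t. c * t\<^sup>2 / 2"])
    fix t :: real assume t: "t \<in> {0..1}"
    show "((\<lambda>t. g (l t)) has_vector_derivative g' (l t) (x - a)) (at t within {0..1})"
      using g[OF l[OF t]] unfolding l_def by (rule has_vector_derivative_along_line)
    show "((\<lambda>t. c * t\<^sup>2 / 2) has_vector_derivative c * t) (at t within {0..1})"
      by (auto intro!: derivative_eq_intros simp: has_real_derivative_iff_has_vector_derivative[symmetric])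
    show "N (g' (l t) (x - a)) \<le> c * t"
      using g'[OF l[OF t], of "x - a"] l_norm[OF t] by (simp add: c_def power2_eq_square algebra_simps)
  qed simp
  then show ?thesis by (simp add: l_def c_def)
qed

section \<open>Fixed points and the Newton-Kantorovich theorem\<close>

text \<open>A minimiser of \<open>N (g z - z)\<close> over a compact set is a fixed point, since applying the contraction
  \<open>g\<close> once more would decrease it; this avoids completeness with respect to \<open>N\<close>.\<close>
lemma is_norm_contraction_fixpoint:
  fixes N :: "'a::euclidean_space \<Rightarrow> real" and g :: "'a \<Rightarrow> 'a"
  assumes N: "is_norm N" and S: "compact S" "S \<noteq> {}" and cont: "continuous_on S g"
    and into: "\<And>z. z \<in> S \<Longrightarrow> g z \<in> S" and "q < 1"
    and contr: "\<And>x y. x \<in> S \<Longrightarrow> y \<in> S \<Longrightarrow> N (g y - g x) \<le> q * N (y - x)"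
  obtains z where "z \<in> S" "g z = z"
proof -
  have "continuous_on S (\<lambda>z. N (g z - z))"
    by (intro continuous_on_compose2[OF continuous_on_is_norm[OF N, of UNIV]] continuous_intros cont subset_UNIV)
  from continuous_attains_inf[OF S this]
  obtain z where z: "z \<in> S" "\<And>y. y \<in> S \<Longrightarrow> N (g z - z) \<le> N (g y - y)" by blast
  have "N (g z - z) \<le> q * N (g z - z)"
    using z(2)[OF into[OF z(1)]] contr[OF z(1) into[OF z(1)]] by simp
  moreover have "q * N (g z - z) < N (g z - z)" if "0 < N (g z - z)" using that \<open>q < 1\<close> by simp
  ultimately have "N (g z - z) = 0" using is_normD(1)[OF N, of "g z - z"] by argo
  then have "g z = z" using is_normD(2)[OF N] by simp
  with z(1) show ?thesis by (rule that)
qed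

text \<open>The root \<open>d\<close> of the discriminant is positive because
  \<open>2 * \<omega> * \<beta> < 1\<close> is strict. Hence \<open>\<omega> * r = 1 - d\<close>
  lies below 1 and can serve as a contraction constant.\<close>

lemma newton_kantorovich_radius:
  fixes \<beta> \<omega> :: real
  assumes "0 \<le> \<beta>" "0 \<le> \<omega>" "2 * \<omega> * \<beta> < 1"
    and r: "r = (if \<omega> = 0 then \<beta> else (1 - sqrt (1 - 2 * \<omega> * \<beta>)) / \<omega>)"
  shows "0 \<le> r" "\<omega> * r < 1" "\<beta> + \<omega> * r\<^sup>2 / 2 = r"
proof -
  have "0 \<le> r \<and> \<omega> * r < 1 \<and> \<beta> + \<omega> * r\<^sup>2 / 2 = r"
  proof (cases "\<omega> = 0")
    case False
    define d where "d = sqrt (1 - 2 * \<omega> * \<beta>)"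
    have d: "0 < d" "d \<le> 1" "d\<^sup>2 = 1 - 2 * \<omega> * \<beta>" using assms by (auto simp: d_def)
    have \<omega>r: "\<omega> * r = 1 - d" using False r by (simp add: d_def)
    have "0 \<le> r" using r d False assms by (simp add: d_def[symmetric])
    \<comment> \<open>Multiplied by \<open>2 * \<omega>\<close>, the equation involves
      \<open>r\<close> only through \<open>\<omega> * r = 1 - d\<close>, and reads
      \<open>(1 - d^2) + (1 - d)^2 = 2 * (1 - d)\<close>.\<close>
    have "2 * \<omega> * (\<beta> + \<omega> * r\<^sup>2 / 2) = 2 * \<omega> * \<beta> + (\<omega> * r)\<^sup>2" by (simp add: power2_eq_square algebra_simps)
    also have "\<dots> = 2 * (1 - d)" using d(3) unfolding \<omega>r by (simp add: power2_eq_square algebra_simps)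
    also have "\<dots> = 2 * \<omega> * r" using \<omega>r by simp
    finally have "\<beta> + \<omega> * r\<^sup>2 / 2 = r" using False by simp
    then show ?thesis using \<omega>r d \<open>0 \<le> r\<close> by simp
  qed (use assms in simp)
  then show "0 \<le> r" "\<omega> * r < 1" "\<beta> + \<omega> * r\<^sup>2 / 2 = r" by auto
qed

text \<open>The general form, for a differentiable self-map of a Euclidean space; the residual map
  is an instance. An extended real \<open>\<rho>\<close> admits an infinite tube.\<close>

theorem newton_kantorovich:
  fixes f :: "'a::euclidean_space \<Rightarrow> 'a" and N :: "'a \<Rightarrow> real" and \<rho> :: ereal
  assumes N: "is_norm N"
    and f: "\<And>z. ereal (N (z - a)) \<le> \<rho> \<Longrightarrow> (f has_derivative f' z) (at z)"
    and bij: "bij (f' a)" and "0 \<le> \<omega>" and "0 < \<rho>"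
    and lipschitz: "\<And>z z'. ereal (N (z - a)) \<le> \<rho> \<Longrightarrow> ereal (N (z' - a)) \<le> \<rho> \<Longrightarrow>
      op_norm N (\<lambda>h. inv (f' a) (f' z h - f' z' h)) \<le> \<omega> * N (z - z')"
    and \<beta>: "\<beta> = N (inv (f' a) (f a))" and small: "2 * \<omega> * \<beta> < 1"
    and r: "r = (if \<omega> = 0 then \<beta> else (1 - sqrt (1 - 2 * \<omega> * \<beta>)) / \<omega>)" and "ereal r < \<rho>"
  shows "\<exists>z. N (z - a) \<le> r \<and> f z = 0 \<and>
           (\<forall>R::real. r < R \<and> ereal R < min \<rho> (if \<omega> = 0 then \<infinity> else ereal (1 / \<omega>)) \<longrightarrow>
              {w. N (w - a) < R \<and> f w = 0} = {z})"
proof -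
  define K where "K = inv (f' a)"
  define g where "g z = z - K (f z)" for z
  have a: "ereal (N (a - a)) \<le> \<rho>" using \<open>0 < \<rho>\<close> is_normD(2)[OF N, of 0] by (simp add: zero_ereal_def)
  have lin_f': "linear (f' z)" if "ereal (N (z - a)) \<le> \<rho>" for z
    using f[OF that] by (rule has_derivative_linear)
  have K: "linear K" unfolding K_def by (rule inj_linear_imp_inv_linear) (use lin_f'[OF a] bij in \<open>auto simp: bij_is_inj\<close>)
  have K_f': "K (f' a h) = h" for h unfolding K_def using bij by (simp add: bij_is_inj)
  \<comment> \<open>Since \<open>K\<close> kills only 0, the fixed points of \<open>g\<close> are
    exactly the zeros of \<open>f\<close>.\<close>
  have K_0: "K y = 0 \<longleftrightarrow> y = 0" for y
    using bij_is_surj[OF bij] linear_0[OF K] linear_0[OF lin_f'[OF a]] unfolding K_def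
    by (metis surj_f_inv_f)
  have g: "(g has_derivative (\<lambda>h. h - K (f' z h))) (at z)" if "ereal (N (z - a)) \<le> \<rho>" for z
    unfolding g_def
    using K by (intro has_derivative_diff has_derivative_ident
        bounded_linear.has_derivative[OF _ f[OF that]]) (simp add: linear_conv_bounded_linear)
  \<comment> \<open>As \<open>K\<close> inverts \<open>f' a\<close>, the left side is
    \<open>K (f' a h - f' z h)\<close>, and the Lipschitz hypothesis applies with the centre
    \<open>a\<close> as one of its points.\<close>
  have g': "N (h - K (f' z h)) \<le> \<omega> * N (z - a) * N h" if z: "ereal (N (z - a)) \<le> \<rho>" for z h
  proof -
    define A where "A = (\<lambda>h. K (f' a h - f' z h))"
    have "linear A" unfolding A_def
      using linear_compose[OF linear_compose_sub[OF lin_f'[OF a] lin_f'[OF z]] K] by (simp add: o_def)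
    then have "N (A h) \<le> op_norm N A * N h" by (rule le_op_norm[OF N])
    also have "\<dots> \<le> \<omega> * N (a - z) * N h"
      using lipschitz[OF a z] is_normD(1)[OF N] unfolding A_def K_def by (intro mult_right_mono) auto
    finally show ?thesis
      using linear_diff[OF K] K_f' by (simp add: A_def is_norm_minus_commute[OF N, of a z])
  qed
  have r_props: "0 \<le> r" "\<omega> * r < 1" "\<beta> + \<omega> * r\<^sup>2 / 2 = r"
    using newton_kantorovich_radius[OF _ \<open>0 \<le> \<omega>\<close> small r] \<beta> is_normD(1)[OF N] by auto
  \<comment> \<open>The radius stays free: \<open>s = r\<close> serves existence,
    \<open>s = R\<close> uniqueness.\<close>
  have contr: "N (g y - g x) \<le> \<omega> * s * N (y - x)"
    if s: "ereal s < \<rho>" and x: "N (x - a) \<le> s" and y: "N (y - a) \<le> s" for s x y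
  proof -
    have "ereal (N (z - a)) \<le> \<rho>" if "N (z - a) \<le> s" for z
      using that s by (meson ereal_less_eq(3) less_imp_le order_trans)
    then show ?thesis using is_norm_contraction_on_ball[OF N \<open>0 \<le> \<omega>\<close> g g' x y] by blast
  qed
  have tube: "ereal (N (z - a)) \<le> \<rho>" if "N (z - a) \<le> r" for z
    using that \<open>ereal r < \<rho>\<close> by (meson ereal_less_eq(3) less_imp_le order_trans)
  \<comment> \<open>The first Newton step moves the centre by \<open>\<beta>\<close>, the quadratic
    bound adds at most \<open>\<omega> * r^2 / 2\<close>, and the equation for \<open>r\<close> says
    that these sum to \<open>r\<close>.\<close>
  have into: "N (g z - a) \<le> r" if z: "N (z - a) \<le> r" for z
  proof -
    have "N (g z - g a) \<le> \<omega> * (N (z - a))\<^sup>2 / 2"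
      using is_norm_quadratic_bound[OF N g[OF tube] g'[OF tube] z] by blast
    also have "\<dots> \<le> \<omega> * r\<^sup>2 / 2"
      using z \<open>0 \<le> \<omega>\<close> is_normD(1)[OF N] by (intro divide_right_mono mult_left_mono power_mono) auto
    finally have "N (g z - g a) \<le> \<omega> * r\<^sup>2 / 2" .
    moreover have "N (g a - a) = \<beta>" by (simp add: g_def \<beta> K_def is_norm_minus[OF N])
    ultimately show ?thesis using is_normD(3)[OF N, of "g z - g a" "g a - a"] r_props(3) by simp
  qed
  define S where "S = {z. N (z - a) \<le> r}"
  have "a \<in> S" using is_normD(2)[OF N, of 0] r_props(1) by (simp add: S_def)
  moreover have "compact S" unfolding S_def by (rule compact_is_norm_ball[OF N])
  moreover have "continuous_on S g"
    using has_derivative_continuous[OF g[OF tube]]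
    by (intro continuous_at_imp_continuous_on) (simp add: S_def)
  ultimately obtain z where z: "z \<in> S" "g z = z"
    using is_norm_contraction_fixpoint[OF N, of S g "\<omega> * r"] into contr[OF \<open>ereal r < \<rho>\<close>] r_props(2)
    unfolding S_def by (metis empty_iff mem_Collect_eq)
  have zero_iff: "f w = 0 \<longleftrightarrow> g w = w" for w using K_0 by (simp add: g_def)
  have "{w. N (w - a) < R \<and> f w = 0} = {z}"
    if R: "r < R" "ereal R < min \<rho> (if \<omega> = 0 then \<infinity> else ereal (1 / \<omega>))" for R
  proof -
    have "\<omega> * R < 1"
    proof (cases "\<omega> = 0")
      case False
      then have "R < 1 / \<omega>" using R by simp
      then show ?thesis using False \<open>0 \<le> \<omega>\<close> by (simp add: field_simps)
    qed simp
    \<comment> \<open>Both points lie in the closed ball of radius \<open>R\<close>, where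
      \<open>g\<close> contracts with constant \<open>\<omega> * R < 1\<close>, so two distinct
      fixed points are impossible.\<close>
    have "w = z" if w: "N (w - a) < R" "f w = 0" for w
    proof (rule ccontr)
      assume "w \<noteq> z"
      then have "0 < N (w - z)" using is_normD(1,2)[OF N, of "w - z"] by force
      moreover have "N (g w - g z) \<le> \<omega> * R * N (w - z)"
        using contr[of R z w] R w z(1) by (simp add: S_def)
      then have "N (w - z) \<le> \<omega> * R * N (w - z)" using w(2) z(2) by (simp add: zero_iff)
      ultimately show False using \<open>\<omega> * R < 1\<close> by simp
    qed
    then show ?thesis using z R(1) by (auto simp: zero_iff S_def)
  qed
  then show ?thesis using z by (auto simp: zero_iff S_def)
qed

section \<open>Differentiability of the residual map\<close>

lemma C2_on_differentiable:
  assumes "C2_on U f" "x \<in> U"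
  shows "f differentiable (at x)"
  using assms unfolding C2_on_def differentiable_def by blast

lemma differentiable_vec_lambda:
  fixes f :: "'a::real_normed_vector \<Rightarrow> 'i::finite \<Rightarrow> 'b::euclidean_space"
  assumes "\<And>i. (\<lambda>x. f x i) differentiable (at x)"
  shows "(\<lambda>x. \<chi> i. f x i) differentiable (at x)"
proof -
  have "((\<lambda>x. \<chi> i. f x i) has_derivative (\<lambda>h. \<chi> i. frechet_derivative (\<lambda>x. f x i) (at x) h)) (at x)"
    using assms by (subst has_derivative_componentwise_within)
      (auto simp: Basis_vec_def inner_axis intro!: has_derivative_inner_left
        simp: frechet_derivative_works[symmetric])
  then show ?thesis unfolding differentiable_def by blast
qed

text \<open>Each block is \<open>F\<close>, or \<open>B\<close> up to the constant
  \<open>\<Delta>\<close>, composed with the bounded linear map that picks two entries of the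
  trajectory.\<close>

lemma differentiable_residual:
  fixes z :: "real^'n^'t"
  assumes F: "\<And>t. t < T \<Longrightarrow> F differentiable (at (z $ e t, z $ e (Suc t)))"
    and B: "B differentiable (at (z $ e 0, z $ e T))"
  shows "residual T e F B \<Delta> differentiable (at z)"
proof -
  have pair: "(\<lambda>z. (z $ i, z $ j)) differentiable (at z)" for i j :: 't
    by (intro bounded_linear_imp_differentiable bounded_linear_Pair bounded_linear_vec_nth)
  have compose: "(\<lambda>z. G (z $ i, z $ j)) differentiable (at z)" if "G differentiable (at (z $ i, z $ j))"
    for G :: "(real^'n) \<times> (real^'n) \<Rightarrow> real^'n" and i j
    using differentiable_compose[OF that pair] .
  show ?thesis unfolding residual_def Let_def
  proof (rule differentiable_vec_lambda)
    fix i
    show "(\<lambda>z. if inv_into {0..T} e i < T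
          then F (z $ e (inv_into {0..T} e i), z $ e (Suc (inv_into {0..T} e i)))
          else B (z $ e 0, z $ e T) - \<Delta>) differentiable (at z)"
      \<comment> \<open>The branch depends on the index \<open>i\<close> only, not on
        \<open>z\<close>, so no differentiability across branches arises.\<close>
      by (cases "inv_into {0..T} e i < T") (auto intro!: compose F B differentiable_diff)
  qed
qed

theorem proposition5p2:
  fixes T :: nat
    and e :: "nat \<Rightarrow> 't::finite"
    and F B :: "(real^'n) \<times> (real^'n) \<Rightarrow> real^'n"
    and U\<^sub>F U\<^sub>B :: "((real^'n) \<times> (real^'n)) set"
    and \<Delta> :: "real^'n"
    and N :: "real^'n^'t \<Rightarrow> real"
    and zbar :: "real^'n^'t"
    and J :: "real^'n^'t \<Rightarrow> real^'n^'t"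
    and \<beta> \<omega> r :: real
    and Rtube :: ereal
  assumes index: "bij_betw e {0..T} (UNIV :: 't set)"
    and F_C2: "C2_on U\<^sub>F F" "(0, 0) \<in> U\<^sub>F"
    and B_C2: "C2_on U\<^sub>B B" "(0, 0) \<in> U\<^sub>B"
    and N_norm: "is_norm N"
    and J_eq: "J = frechet_derivative (residual T e F B \<Delta>) (at zbar)"
    and J_inv: "bij J"
    and beta_eq: "\<beta> = N (inv J (residual T e F B \<Delta> zbar))"
    and omega_nonneg: "0 \<le> \<omega>"
    and Rtube_pos: "0 < Rtube"
    and tube_F: "\<And>z t. ereal (N (z - zbar)) \<le> Rtube \<Longrightarrow> t < T \<Longrightarrow> (z $ e t, z $ e (Suc t)) \<in> U\<^sub>F"
    and tube_B: "\<And>z. ereal (N (z - zbar)) \<le> Rtube \<Longrightarrow> (z $ e 0, z $ e T) \<in> U\<^sub>B"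
    and lipschitz: "\<And>z z'. ereal (N (z - zbar)) \<le> Rtube \<Longrightarrow> ereal (N (z' - zbar)) \<le> Rtube \<Longrightarrow>
      op_norm N (\<lambda>h. inv J (frechet_derivative (residual T e F B \<Delta>) (at z) h
                           - frechet_derivative (residual T e F B \<Delta>) (at z') h))
        \<le> \<omega> * N (z - z')"
    and small: "2 * \<omega> * \<beta> < 1"
    and r_eq: "r = (if \<omega> = 0 then \<beta> else (1 - sqrt (1 - 2 * \<omega> * \<beta>)) / \<omega>)"
    and r_less: "ereal r < Rtube"
  shows "\<exists>z. N (z - zbar) \<le> r \<and> residual T e F B \<Delta> z = 0 \<and>
           (\<forall>R::real. r < R \<and> ereal R < min Rtube (if \<omega> = 0 then \<infinity> else ereal (1 / \<omega>)) \<longrightarrow>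
              {w. N (w - zbar) < R \<and> residual T e F B \<Delta> w = 0} = {z})"
proof -
  let ?R = "residual T e F B \<Delta>"
  \<comment> \<open>\<open>frechet_derivative\<close> is a choice operator, meaningful only at
    points of differentiability; the tube hypotheses place the relevant pairs in the domains where
    \<open>F\<close> and \<open>B\<close> are C2.\<close>
  have "(?R has_derivative frechet_derivative ?R (at z)) (at z)"
    if "ereal (N (z - zbar)) \<le> Rtube" for z
    using that differentiable_residual C2_on_differentiable[OF F_C2(1) tube_F]
      C2_on_differentiable[OF B_C2(1) tube_B]
    by (intro iffD1[OF frechet_derivative_works]) blast
  then show ?thesis
    using J_inv lipschitz beta_eq unfolding J_eq
    by (intro newton_kantorovich[OF N_norm _ _ omega_nonneg Rtube_pos _ _ small r_eq r_less]) auto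
qed

end
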